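(* For every integer $n$, $$\sum_{j=1}^n(-1)^{j-1}F_j^5L_j=\frac{(-1)^{n+1}}{2}F_n^2F_{n+1}^2\bigl(F_nF_{n+3}-F_{n+1}^2\bigr)$$ and $$\sum_{j=1}^n(-1)^{j-1}L_j^5F_j=\frac{(-1)^{n+1}}{10}L_n^2L_{n+1}^2\bigl(L_nL_{n+3}-L_{n+1}^2\bigr)+\frac{14}{5}.$$
   Context: $F_k$ and $L_k$ ($k\in\mathbb Z$) are the Fibonacci and Lucas numbers: $F_0=0$, $F_1=1$, $L_0=2$, $L_1=1$, both satisfying $X_k=X_{k-1}+X_{k-2}$ for all integers $k$ (extended to negative indices by this recurrence). For $n=0$ the sum $\sum_{j=1}^n a_j$ is $0$, and for $n<0$ it is understood as $\sum_{j=1}^n a_j=-\sum_{j=n+1}^{0}a_j$. *)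

theory Defs
  imports Complex_Main "HOL-Number_Theory.Fib"
begin

text \<open>Fibonacci and Lucas numbers at integer indices; for negative indices the
  recurrence is run backwards.\<close>

function fibZ :: "int \<Rightarrow> int" where
  "fibZ k = (if k = 0 then 0 else if k = 1 then 1
     else if k > 1 then fibZ (k - 1) + fibZ (k - 2)
     else fibZ (k + 2) - fibZ (k + 1))"
  by auto
termination
  by (relation "measure (\<lambda>k. if k \<ge> 0 then nat k else nat (1 - k))") auto

function lucZ :: "int \<Rightarrow> int" where
  "lucZ k = (if k = 0 then 2 else if k = 1 then 1
     else if k > 1 then lucZ (k - 1) + lucZ (k - 2)
     else lucZ (k + 2) - lucZ (k + 1))"
  by auto
termination
  by (relation "measure (\<lambda>k. if k \<ge> 0 then nat k else nat (1 - k))") auto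

declare fibZ.simps [simp del] lucZ.simps [simp del]

lemma fibZ_0 [simp]: "fibZ 0 = 0" and fibZ_1 [simp]: "fibZ 1 = 1"
  by (simp_all add: fibZ.simps)

lemma lucZ_0 [simp]: "lucZ 0 = 2" and lucZ_1 [simp]: "lucZ 1 = 1"
  by (simp_all add: lucZ.simps)

lemma fibZ_rec: "fibZ k = fibZ (k - 1) + fibZ (k - 2)"
proof (cases "k > 1")
  case True
  then show ?thesis by (subst fibZ.simps) simp
next
  case False
  then show ?thesis by (subst (3) fibZ.simps) simp
qed

lemma lucZ_rec: "lucZ k = lucZ (k - 1) + lucZ (k - 2)"
proof (cases "k > 1")
  case True
  then show ?thesis by (subst lucZ.simps) simp
next
  case False
  then show ?thesis by (subst (3) lucZ.simps) simp
qed

lemma fibZ_of_nat: "fibZ (int n) = int (fib n)"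
proof (induction n rule: fib.induct)
  case (3 n)
  then show ?case using fibZ_rec [of "int (Suc (Suc n))"] by (simp add: algebra_simps)
qed simp_all

text \<open>The sum of \<open>f j\<close> for \<open>j\<close> from \<open>1\<close> to \<open>n\<close>, with \<open>n\<close> an arbitrary integer.\<close>

definition sum_from_1 :: "(int \<Rightarrow> real) \<Rightarrow> int \<Rightarrow> real" where
  "sum_from_1 f n = (if n \<ge> 0 then \<Sum>j=1..n. f j else - (\<Sum>j=n+1..0. f j))"

end

theory Submission
  imports Defs
begin

text \<open>
  Both identities are one telescoping sum. Let \<open>G\<close> be any sequence with
  \<open>G (k + 2) = G (k + 1) + G k\<close> and put
  \<open>T n = (-1)^(n+1) / 2 * (G n)^2 * (G (n+1))^2 * (G n * G (n+3) - (G (n+1))^2)\<close>.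
  Writing \<open>G (n-1)\<close>, \<open>G (n+2)\<close> and \<open>G (n+3)\<close> in terms of \<open>a = G n\<close> and \<open>b = G (n+1)\<close>,
  the alternating sign turns \<open>T n - T (n-1)\<close> into \<open>(-1)^(n-1) * a^2 / 2\<close> times
  \<open>b^2 * (a^2 + 2*a*b - b^2) + (b - a)^2 * (b^2 - 2*a^2) = 2 * a^3 * (2*b - a)\<close>,
  so the difference is \<open>(-1)^(n-1) * a^5 * (2*b - a)\<close> whatever the initial values are
  (\<open>gibonacci_telescope\<close>). The factor \<open>2*b - a = G (n-1) + G (n+1)\<close> is the sequence
  companion to \<open>G\<close>: it is \<open>L n\<close> when \<open>G = F\<close>, and \<open>5 * F n\<close> when \<open>G = L\<close>.
  The first identity has no constant because \<open>F 0 = 0\<close>; the second is divided by \<open>5\<close>, and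
  its constant is \<open>- T 0 / 5 = 14 / 5\<close>.
\<close>

lemma int_step_induct:
  fixes P :: "int \<Rightarrow> bool"
  assumes "P 0" and step: "\<And>k. P (k - 1) \<longleftrightarrow> P k"
  shows "P n"
proof (induction n rule: int_induct [where k = 0])
  case (step1 i)
  then show ?case using step [of "i + 1"] by simp
qed (use assms in simp_all)

text \<open>The sign convention for negative upper limits is the one that makes this recurrence
  hold at every integer, so that sums telescope in both directions.\<close>

lemma sum_from_1_rec: "sum_from_1 f n = sum_from_1 f (n - 1) + f n"
proof -
  consider "n \<ge> 1" | "n = 0" | "n < 0" by linarith
  then show ?thesis
  proof cases
    case 1
    then have "{1..n} = insert n {1..n - 1}" by auto
    then show ?thesis using 1 by (simp add: sum_from_1_def)
  next
    case 2
    then show ?thesis by (simp add: sum_from_1_def)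
  next
    case 3
    then have "{n..0} = insert n {n + 1..0}" by auto
    then show ?thesis using 3 by (simp add: sum_from_1_def)
  qed
qed

lemma sum_from_1_telescope:
  assumes "\<And>k. T k - T (k - 1) = f k"
  shows "sum_from_1 f n = T n - T 0"
proof (induction n rule: int_step_induct)
  case 1
  show ?case by (simp add: sum_from_1_def)
next
  case (2 k)
  show ?case using sum_from_1_rec [of f k] assms [of k] by auto
qed

lemma gibonacci_telescope:
  fixes G :: "int \<Rightarrow> real" and n :: int
  assumes rec: "\<And>k. G k = G (k - 1) + G (k - 2)"
  defines "T \<equiv> \<lambda>k. (-1) powi (k + 1) / 2 * G k ^ 2 * G (k + 1) ^ 2
                     * (G k * G (k + 3) - G (k + 1) ^ 2)"
  shows "sum_from_1 (\<lambda>j. (-1) powi (j - 1) * G j ^ 5 * (2 * G (j + 1) - G j)) n = T n - T 0"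
proof (rule sum_from_1_telescope)
  fix k
  define a b where "a = G k" and "b = G (k + 1)"
  define s :: real where "s = (-1) powi (k - 1)"
  have signs: "(-1::real) powi (k + 1) = s" "(-1::real) powi k = - s"
    by (auto simp: s_def power_int_minus_left)
  have G_terms: "G (k - 1) = b - a" "G (k + 2) = a + b" "G (k + 3) = a + 2 * b"
    using rec [of "k + 1"] rec [of "k + 2"] rec [of "k + 3"]
    by (simp_all add: a_def b_def algebra_simps)
  have "T k - T (k - 1) = s / 2 * a ^ 2 * b ^ 2 * (a * (a + 2 * b) - b ^ 2)
      + s / 2 * (b - a) ^ 2 * a ^ 2 * ((b - a) * (a + b) - a ^ 2)"
    by (simp add: T_def signs G_terms add.commute [of 2 k] flip: a_def b_def)
  also have "\<dots> = s * a ^ 5 * (2 * b - a)"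
    by (simp add: field_simps eval_nat_numeral)
  finally show "T k - T (k - 1) = (-1) powi (k - 1) * G k ^ 5 * (2 * G (k + 1) - G k)"
    by (simp add: s_def a_def b_def)
qed

lemma fibZ_lucZ_companion:
  "lucZ n = 2 * fibZ (n + 1) - fibZ n \<and> 5 * fibZ n = 2 * lucZ (n + 1) - lucZ n"
proof -
  \<comment> \<open>All terms satisfy the same second-order recurrence, so agreement at two consecutive
    indices is what propagates in both directions.\<close>
  define P where "P k \<longleftrightarrow> lucZ k = 2 * fibZ (k + 1) - fibZ k
    \<and> 5 * fibZ k = 2 * lucZ (k + 1) - lucZ k" for k
  have "P n \<and> P (n + 1)"
  proof (induction n rule: int_step_induct)
    case 1
    show ?case using fibZ_rec [of 2] lucZ_rec [of 2] by (simp add: P_def)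
  next
    case (2 k)
    show ?case
      using fibZ_rec [of "k + 1"] lucZ_rec [of "k + 1"] fibZ_rec [of "k + 2"] lucZ_rec [of "k + 2"]
      by (auto simp: P_def algebra_simps)
  qed
  then show ?thesis by (simp add: P_def)
qed

lemma sum_from_1_divide: "sum_from_1 (\<lambda>j. f j / c) n = sum_from_1 f n / c"
  by (simp add: sum_from_1_def sum_divide_distrib)

theorem mainTheorem4:
  fixes n :: int
  shows "(sum_from_1 (\<lambda>j. (-1) powi (j - 1) * real_of_int (fibZ j) ^ 5 * real_of_int (lucZ j)) n
       = (-1) powi (n + 1) / 2 * real_of_int (fibZ n) ^ 2 * real_of_int (fibZ (n + 1)) ^ 2
         * (real_of_int (fibZ n) * real_of_int (fibZ (n + 3)) - real_of_int (fibZ (n + 1)) ^ 2))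
    \<and> (sum_from_1 (\<lambda>j. (-1) powi (j - 1) * real_of_int (lucZ j) ^ 5 * real_of_int (fibZ j)) n
       = (-1) powi (n + 1) / 10 * real_of_int (lucZ n) ^ 2 * real_of_int (lucZ (n + 1)) ^ 2
         * (real_of_int (lucZ n) * real_of_int (lucZ (n + 3)) - real_of_int (lucZ (n + 1)) ^ 2)
         + 14 / 5)"
proof
  have luc: "real_of_int (lucZ j) = 2 * real_of_int (fibZ (j + 1)) - real_of_int (fibZ j)" for j
    using fibZ_lucZ_companion [of j] by simp
  have fib_rec: "real_of_int (fibZ k) = real_of_int (fibZ (k - 1)) + real_of_int (fibZ (k - 2))" for k
    using fibZ_rec [of k] by linarith
  show "sum_from_1 (\<lambda>j. (-1) powi (j - 1) * real_of_int (fibZ j) ^ 5 * real_of_int (lucZ j)) n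
       = (-1) powi (n + 1) / 2 * real_of_int (fibZ n) ^ 2 * real_of_int (fibZ (n + 1)) ^ 2
         * (real_of_int (fibZ n) * real_of_int (fibZ (n + 3)) - real_of_int (fibZ (n + 1)) ^ 2)"
    using gibonacci_telescope [of "\<lambda>k. real_of_int (fibZ k)" n, OF fib_rec] by (simp add: luc)
next
  have fib: "real_of_int (fibZ j) = (2 * real_of_int (lucZ (j + 1)) - real_of_int (lucZ j)) / 5" for j
  proof -
    have "5 * real_of_int (fibZ j) = 2 * real_of_int (lucZ (j + 1)) - real_of_int (lucZ j)"
      using arg_cong [OF conjunct2 [OF fibZ_lucZ_companion [of j]], of real_of_int] by simp
    then show ?thesis by simp
  qed
  have luc_rec: "real_of_int (lucZ k) = real_of_int (lucZ (k - 1)) + real_of_int (lucZ (k - 2))" for k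
    using lucZ_rec [of k] by linarith
  have luc_3: "lucZ 3 = 4"
    using lucZ_rec [of 2] lucZ_rec [of 3] by simp
  have "sum_from_1 (\<lambda>j. (-1) powi (j - 1) * real_of_int (lucZ j) ^ 5 * real_of_int (fibZ j)) n
      = sum_from_1 (\<lambda>j. (-1) powi (j - 1) * real_of_int (lucZ j) ^ 5
          * (2 * real_of_int (lucZ (j + 1)) - real_of_int (lucZ j))) n / 5"
    by (simp add: fib flip: sum_from_1_divide)
  then show "sum_from_1 (\<lambda>j. (-1) powi (j - 1) * real_of_int (lucZ j) ^ 5 * real_of_int (fibZ j)) n
       = (-1) powi (n + 1) / 10 * real_of_int (lucZ n) ^ 2 * real_of_int (lucZ (n + 1)) ^ 2
         * (real_of_int (lucZ n) * real_of_int (lucZ (n + 3)) - real_of_int (lucZ (n + 1)) ^ 2)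
         + 14 / 5"
    using gibonacci_telescope [of "\<lambda>k. real_of_int (lucZ k)" n, OF luc_rec]
    by (simp add: luc_3 field_simps)
qed

end
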